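(* Let $m$ be a quasi-Bernoulli measure on $[0,1)^D$ with dimension $d=-\tau'(1)$. Suppose that there exists a real $\sigma\ge0$ such that $\tau(1-q)=qd+\frac{\sigma^2}{2}q^2+o(q^2)$ in a neighborhood of $q=0$. Then, $m$-almost surely, $$\limsup_{n\to+\infty}\frac{S_n-nd}{\sqrt{2n\log_\ell\log_\ell n}}\le\sigma\qquad\text{and}\qquad\liminf_{n\to+\infty}\frac{S_n-nd}{\sqrt{2n\log_\ell\log_\ell n}}\ge-\sigma.$$
   Context: Fix integers $D\ge1$, $\ell\ge2$. $\mathcal F_n$ is the family of $\ell$-adic cubes $\prod_{i=1}^D[k_i/\ell^n,(k_i+1)/\ell^n)$, $0\le k_i<\ell^n$. For each $n$ the cubes of $\mathcal F_n$ are coded bijectively as $I_{\varepsilon_1\cdots\varepsilon_n}$, $\varepsilon_i\in\{0,\dots,\ell^D-1\}$, with $I_{\varepsilon_1\cdots\varepsilon_{n+1}}\subset I_{\varepsilon_1\cdots\varepsilon_n}$. For $I=I_{\varepsilon_1\cdots\varepsilon_n}\in\mathcal F_n$ and $J=I_{\varepsilon_{n+1}\cdots\varepsilon_{n+p}}\in\mathcal F_p$, let $IJ=I_{\varepsilon_1\cdots\varepsilon_{n+p}}\in\mathcal F_{n+p}$. A Borel probability measure $m$ on $[0,1)^D$ is quasi-Bernoulli if there is a constant $C\ge1$ with $\frac1Cm(I)m(J)\le m(IJ)\le C\,m(I)m(J)$ for all $I,J\in\bigcup_n\mathcal F_n$. The $L^q$-spectrum is $\tau(q)=\limsup_{n\to\infty}\frac{1}{n\log\ell}\log\left(\sum_{I\in\mathcal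 F_n}m(I)^q\right)$, $q\in\mathbb R$ (sum over cubes with $m(I)>0$). For quasi-Bernoulli $m$ it is known that $\tau$ is convex and $C^1$ on $\mathbb R$, and that $d=-\tau'(1)$ is the dimension of $m$. $I_n(x)$ is the cube of $\mathcal F_n$ containing $x$, and $S_n(x)=-\log_\ell m(I_n(x))$. *)

theory Defs
  imports "HOL-Probability.Probability" "HOL-Library.Landau_Symbols"
begin

text \<open>The ambient dimension D is \<open>CARD('d)\<close>.\<close>

definition unit_cube :: "(real ^ 'd) set" where
  "unit_cube = {x. \<forall>i. 0 \<le> x $ i \<and> x $ i < 1}"

definition adic_cube :: "nat \<Rightarrow> nat \<Rightarrow> ('d \<Rightarrow> nat) \<Rightarrow> (real ^ 'd) set" where
  "adic_cube l n k =
     {x. \<forall>i. real (k i) / real l ^ n \<le> x $ i \<and> x $ i < (real (k i) + 1) / real l ^ n}"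

definition adic_cubes :: "nat \<Rightarrow> nat \<Rightarrow> (real ^ 'd) set set" where
  "adic_cubes l n = {adic_cube l n k | k. \<forall>i. k i < l ^ n}"

definition adic_cube_at :: "nat \<Rightarrow> nat \<Rightarrow> real ^ 'd \<Rightarrow> (real ^ 'd) set" where
  "adic_cube_at l n x = (THE I. I \<in> adic_cubes l n \<and> x \<in> I)"

definition words :: "nat \<Rightarrow> nat set \<Rightarrow> nat list set" where
  "words n A = {w. length w = n \<and> set w \<subseteq> A}"

definition cube_coding :: "nat \<Rightarrow> (nat list \<Rightarrow> (real ^ 'd::finite) set) \<Rightarrow> bool" where
  "cube_coding l cube \<longleftrightarrow>
     (\<forall>n. bij_betw cube (words n {..<l ^ CARD('d)}) (adic_cubes l n)) \<and>
     (\<forall>w e. w \<in> lists {..<l ^ CARD('d)} \<longrightarrow> e < l ^ CARD('d) \<longrightarrow> cube (w @ [e]) \<subseteq> cube w)"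

definition borel_prob_on_unit_cube :: "(real ^ 'd::finite) measure \<Rightarrow> bool" where
  "borel_prob_on_unit_cube m \<longleftrightarrow>
     prob_space m \<and> sets m = sets (restrict_space borel unit_cube)"

text \<open>The cubes \<open>I\<close> and \<open>J\<close> range over the codes \<open>u\<close> and \<open>v\<close>; the product cube \<open>IJ\<close> is the one
  coded by \<open>u @ v\<close>.  The empty word codes the whole unit cube, for which both inequalities
  are trivial.\<close>

definition quasi_Bernoulli ::
    "nat \<Rightarrow> (nat list \<Rightarrow> (real ^ 'd::finite) set) \<Rightarrow> (real ^ 'd) measure \<Rightarrow> bool" where
  "quasi_Bernoulli l cube m \<longleftrightarrow>
     borel_prob_on_unit_cube m \<and>
     (\<exists>C\<ge>1. \<forall>u \<in> lists {..<l ^ CARD('d)}. \<forall>v \<in> lists {..<l ^ CARD('d)}.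
        1 / C * measure m (cube u) * measure m (cube v) \<le> measure m (cube (u @ v)) \<and>
        measure m (cube (u @ v)) \<le> C * measure m (cube u) * measure m (cube v))"

text \<open>The upper limit is taken in the extended reals; it is finite for quasi-Bernoulli measures,
  so that \<open>real_of_ereal\<close> loses nothing there.\<close>

definition Lq_spectrum :: "nat \<Rightarrow> (real ^ 'd::finite) measure \<Rightarrow> real \<Rightarrow> real" where
  "Lq_spectrum l m q = real_of_ereal (limsup (\<lambda>n. ereal (1 / (real n * ln (real l)) *
     ln (\<Sum>I \<in> {I \<in> adic_cubes l n. measure m I > 0}. measure m I powr q))))"

text \<open>Almost surely all the cubes \<open>adic_cube_at l n x\<close> have positive measure, so the value of
  \<open>log\<close> at 0 does not matter.\<close>

definition log_mass :: "nat \<Rightarrow> (real ^ 'd::finite) measure \<Rightarrow> nat \<Rightarrow> real ^ 'd \<Rightarrow> real" where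
  "log_mass l m n x = - log (real l) (measure m (adic_cube_at l n x))"

end

theory Submission
  imports Defs "HOL-Real_Asymp.Real_Asymp"
begin

text \<open>
  Write \<open>S k x = log_mass l m k x\<close>, \<open>\<tau> = Lq_spectrum l m\<close> and
  \<open>Z t n = (\<Sum>I. m I powr t)\<close>, the sum being over the cubes of generation \<open>n\<close>.  The proof has
  two parts: exponential moments of \<open>S n\<close> that are sharp up to a constant, and the classical argument
  for the upper half of the law of the iterated logarithm (Chernoff bound, maximal inequality,
  geometric blocks, Borel--Cantelli).

  The exponential moment of \<open>S n\<close> at \<open>q\<close> is \<open>Z (1 - q) n\<close>, because on a cube of mass \<open>M\<close> one has
  \<open>l powr (q * S n) = M powr (- q)\<close>.  The quasi-Bernoulli property makes
  \<open>Z t\<close> multiplicative up to a factor \<open>C powr t\<close>, so that \<open>ln (Z t n)\<close> is additive up to a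
  constant.  Such a sequence stays within the same constant of a linear one
  (\<open>almost_additive_asymptotics\<close>), whose slope is the spectrum by its definition.  Hence
  \<open>Z t n\<close> and \<open>l powr (n * \<tau> t)\<close> are comparable uniformly in \<open>n\<close>
  (\<open>partition_fun_bounds\<close>).

  The same comparison inside one cube says that \<open>l powr (q * S k - k * \<tau> (1 - q))\<close> is, up to a
  constant, a martingale for the filtration of the cubes.  A Doob inequality for trees
  (\<open>tree_maximal_inequality\<close>) then shows that it exceeds \<open>b\<close> at some time \<open>k \<le> n\<close> with
  probability at most \<open>C ^ 6 / b\<close>, for \<open>\<bar>q\<bar> \<le> 1\<close> (\<open>measure_exceptional\<close>).

  Let \<open>a > \<sigma>\<close> and let \<open>\<phi> n\<close> be the denominator in the theorem.  Choose \<open>V\<close> between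
  \<open>\<sigma>\<^sup>2\<close> and \<open>a\<^sup>2\<close>; the expansion of \<open>\<tau>\<close> gives \<open>\<tau> (1 - q) \<le> q * d + V / 2 * q\<^sup>2\<close> for
  small \<open>q\<close>.  On the block \<open>\<rho> ^ j \<le> k < \<rho> ^ Suc j\<close> take the optimal
  \<open>q = a * \<phi> (\<rho> ^ j) / (\<rho> ^ Suc j * V)\<close>, which tends to 0.  The probability that
  \<open>S k - k * d\<close> exceeds \<open>a * \<phi> k\<close> somewhere in the block is then at most a constant times
  \<open>j powr - \<beta>\<close> with \<open>\<beta> = a\<^sup>2 / (\<rho> * V)\<close>, and \<open>\<beta> > 1\<close> as soon as \<open>\<rho>\<close> is close to 1.
  Borel--Cantelli concludes; replacing \<open>q\<close> by \<open>- q\<close> bounds the deviations below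
  (\<open>one_sided_bound\<close>).
\<close>

section \<open>Almost additive sequences\<close>

text \<open>A two-sided form of Fekete's lemma.  Comparing \<open>a (n * p)\<close> with both \<open>n * a p\<close> and
  \<open>p * a n\<close> shows that \<open>a n / n\<close> and \<open>a p / p\<close> differ by at most \<open>c / n + c / p\<close>; this makes the
  quotients a Cauchy sequence, and letting \<open>n\<close> tend to infinity bounds the error at \<open>p\<close>.\<close>

lemma almost_additive_asymptotics:
  fixes a :: "nat \<Rightarrow> real"
  assumes add: "\<And>n p. \<bar>a (n + p) - a n - a p\<bar> \<le> c"
  obtains L where "(\<lambda>n. a n / real n) \<longlonglongrightarrow> L" and "\<And>n. \<bar>a n - real n * L\<bar> \<le> c"
proof -
  have c0: "0 \<le> c"
    using add[of 0 0] by linarith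
  have mult: "\<bar>a (n * p) - real n * a p\<bar> \<le> real n * c" if "n > 0" for n p
  proof -
    from that obtain k where n: "n = Suc k" by (cases n) auto
    have "\<bar>a (Suc k * p) - real (Suc k) * a p\<bar> \<le> real (Suc k) * c"
    proof (induction k)
      case 0
      show ?case using c0 by simp
    next
      case (Suc k)
      have "\<bar>a (Suc k * p + p) - a (Suc k * p) - a p\<bar> \<le> c" by (rule add)
      with Suc show ?case by (simp add: algebra_simps)
    qed
    with n show ?thesis by simp
  qed
  have ratio: "\<bar>a (n * p) / real (n * p) - a p / real p\<bar> \<le> c / real p"
    if "n > 0" "p > 0" for n p
  proof -
    have "a (n * p) / real (n * p) - a p / real p = (a (n * p) - real n * a p) / real (n * p)"
      using that by (simp add: field_simps)
    then have "\<bar>a (n * p) / real (n * p) - a p / real p\<bar> = \<bar>a (n * p) - real n * a p\<bar> / real (n * p)"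
      by (simp add: abs_divide)
    also have "\<dots> \<le> (real n * c) / real (n * p)"
      by (rule divide_right_mono[OF mult[OF that(1)]]) simp
    also have "\<dots> = c / real p" using that by simp
    finally show ?thesis .
  qed
  have close: "\<bar>a n / real n - a p / real p\<bar> \<le> c / real n + c / real p"
    if "n > 0" "p > 0" for n p
    using ratio[OF that] ratio[OF that(2) that(1)] by (simp add: mult.commute)
  have "Cauchy (\<lambda>n. a n / real n)"
  proof (rule metric_CauchyI)
    fix e :: real assume e: "e > 0"
    have "(\<lambda>n. c / real n) \<longlonglongrightarrow> 0" by real_asymp
    then have "eventually (\<lambda>n. c / real n < e / 2) sequentially"
      using e by (intro order_tendstoD(2)[where y = 0]) auto
    then obtain M where M: "\<And>n. n \<ge> M \<Longrightarrow> c / real n < e / 2"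
      by (auto simp: eventually_sequentially)
    show "\<exists>M. \<forall>n\<ge>M. \<forall>p\<ge>M. dist (a n / real n) (a p / real p) < e"
    proof (intro exI[of _ "Suc M"] allI impI)
      fix n p assume "n \<ge> Suc M" "p \<ge> Suc M"
      then show "dist (a n / real n) (a p / real p) < e"
        using close[of n p] M[of n] M[of p] unfolding dist_real_def by linarith
    qed
  qed
  then obtain L where L: "(\<lambda>n. a n / real n) \<longlonglongrightarrow> L"
    by (auto simp: Cauchy_convergent_iff convergent_def)
  have "\<bar>a p - real p * L\<bar> \<le> c" for p
  proof (cases "p = 0")
    case True
    then show ?thesis using add[of 0 0] by simp
  next
    case False
    have "(\<lambda>n. \<bar>a n / real n - a p / real p\<bar>) \<longlonglongrightarrow> \<bar>L - a p / real p\<bar>"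
      by (intro tendsto_intros L)
    moreover have "(\<lambda>n. c / real n + c / real p) \<longlonglongrightarrow> 0 + c / real p"
      by (intro tendsto_add tendsto_const) real_asymp
    moreover have "\<exists>M. \<forall>n\<ge>M. \<bar>a n / real n - a p / real p\<bar> \<le> c / real n + c / real p"
      using close False by (intro exI[of _ 1]) auto
    ultimately have "\<bar>L - a p / real p\<bar> \<le> 0 + c / real p"
      by (rule LIMSEQ_le)
    then have "real p * \<bar>L - a p / real p\<bar> \<le> c"
      using False by (simp add: field_simps)
    moreover have "real p * \<bar>L - a p / real p\<bar> = \<bar>a p - real p * L\<bar>"
      using False by (simp add: abs_mult_pos' abs_minus_commute right_diff_distrib)
    ultimately show ?thesis by simp
  qed
  with L that show thesis by blast
qed

section \<open>Words\<close>

lemma finite_words [simp]: "finite A \<Longrightarrow> finite (words n A)"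
  using finite_lists_length_eq[of A n] by (simp add: words_def conj_commute)

lemma words_0 [simp]: "words 0 A = {[]}"
  by (auto simp: words_def)

lemma words_subset_lists: "w \<in> words n A \<Longrightarrow> w \<in> lists A"
  by (auto simp: words_def)

lemma take_in_words: "w \<in> words n A \<Longrightarrow> k \<le> n \<Longrightarrow> take k w \<in> words k A"
  by (auto simp: words_def dest: in_set_takeD)

lemma sum_words_append:
  "(\<Sum>w\<in>words (n + p) A. f w) = (\<Sum>u\<in>words n A. \<Sum>v\<in>words p A. f (u @ v))"
proof -
  have "bij_betw (\<lambda>(u, v). u @ v) (words n A \<times> words p A) (words (n + p) A)"
  proof (rule bij_betwI[where g = "\<lambda>w. (take n w, drop n w)"])
    show "(\<lambda>w. (take n w, drop n w)) \<in> words (n + p) A \<rightarrow> words n A \<times> words p A"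
      by (auto simp: words_def dest: in_set_takeD in_set_dropD)
  qed (auto simp: words_def)
  then show ?thesis
    by (subst sum.reindex_bij_betw[symmetric]) (simp_all add: sum.cartesian_product case_prod_unfold)
qed

lemma sum_words_Suc:
  "(\<Sum>w\<in>words (Suc n) A. f w) = (\<Sum>e\<in>A. \<Sum>v\<in>words n A. f (e # v))"
proof -
  have "words (Suc 0) A = (\<lambda>e. [e]) ` A"
    by (auto simp: words_def length_Suc_conv)
  moreover have "inj_on (\<lambda>e. [e]) A" by (auto simp: inj_on_def)
  ultimately show ?thesis
    using sum_words_append[of f "Suc 0" n A] by (simp add: sum.reindex)
qed

text \<open>Doob's maximal inequality on a finite tree.  The letters label the children of a node,
  \<open>\<mu>\<close> is the mass of the cylinder below a node, and the ratio \<open>f / \<mu>\<close> is the process, a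
  submartingale up to the factor \<open>K\<close>.  Splitting by the first letter replaces
  the stopping time: either the process is already above \<open>b\<close> at \<open>w\<close>, and the bound holds for the
  whole subtree, or the event decomposes over the children of \<open>w\<close>.  Phrasing the event as
  \<open>b * \<mu> \<le> f\<close> also puts nodes of mass 0 where \<open>f\<close> vanishes into it, at no cost.\<close>

lemma tree_maximal_inequality:
  fixes \<mu> f :: "nat list \<Rightarrow> real"
  assumes A: "finite A" and "0 \<le> b" and "0 \<le> K"
    and f_nonneg: "\<And>w. w \<in> lists A \<Longrightarrow> 0 \<le> f w"
    and mass: "\<And>w r. w \<in> lists A \<Longrightarrow> (\<Sum>v\<in>words r A. \<mu> (w @ v)) \<le> \<mu> w"
    and sub: "\<And>w r. w \<in> lists A \<Longrightarrow> f w \<le> K * (\<Sum>v\<in>words r A. f (w @ v))"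
    and w: "w \<in> lists A"
  shows "b * (\<Sum>v | v \<in> words r A \<and> (\<exists>k\<le>r. b * \<mu> (w @ take k v) \<le> f (w @ take k v)). \<mu> (w @ v))
         \<le> K * (\<Sum>v\<in>words r A. f (w @ v))"
  using w
proof (induction r arbitrary: w)
  case 0
  then show ?case using sub[of w 0] f_nonneg[of w] \<open>0 \<le> K\<close>
    by (cases "b * \<mu> w \<le> f w") auto
next
  case (Suc r)
  show ?case
  proof (cases "b * \<mu> w \<le> f w")
    case True
    then have "{v. v \<in> words (Suc r) A \<and> (\<exists>k\<le>Suc r. b * \<mu> (w @ take k v) \<le> f (w @ take k v))}
        = words (Suc r) A"
      by (auto intro!: exI[of _ 0])
    then have "b * (\<Sum>v | v \<in> words (Suc r) A \<and>
          (\<exists>k\<le>Suc r. b * \<mu> (w @ take k v) \<le> f (w @ take k v)). \<mu> (w @ v))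
        = b * (\<Sum>v\<in>words (Suc r) A. \<mu> (w @ v))"
      by simp
    also have "\<dots> \<le> b * \<mu> w"
      using mass[OF Suc.prems, of "Suc r"] \<open>0 \<le> b\<close> by (rule mult_left_mono)
    also have "\<dots> \<le> f w" by fact
    also have "\<dots> \<le> K * (\<Sum>v\<in>words (Suc r) A. f (w @ v))"
      by (rule sub[OF Suc.prems])
    finally show ?thesis .
  next
    case False
    define P where "P r w v \<longleftrightarrow> (\<exists>k\<le>r. b * \<mu> (w @ take k v) \<le> f (w @ take k v))" for r w v
    have P_Suc: "P (Suc r) w (e # v) \<longleftrightarrow> P r (w @ [e]) v" for e v
    proof
      assume "P (Suc r) w (e # v)"
      then obtain k where k: "k \<le> Suc r" "b * \<mu> (w @ take k (e # v)) \<le> f (w @ take k (e # v))"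
        by (auto simp: P_def)
      with False obtain k' where "k = Suc k'" by (cases k) auto
      with k show "P r (w @ [e]) v" by (auto simp: P_def)
    next
      assume "P r (w @ [e]) v"
      then obtain k where "k \<le> r" "b * \<mu> (w @ [e] @ take k v) \<le> f (w @ [e] @ take k v)"
        by (auto simp: P_def)
      then show "P (Suc r) w (e # v)"
        unfolding P_def by (intro exI[of _ "Suc k"]) auto
    qed
    have "b * (\<Sum>v | v \<in> words (Suc r) A \<and> P (Suc r) w v. \<mu> (w @ v))
        = b * (\<Sum>v\<in>words (Suc r) A. if P (Suc r) w v then \<mu> (w @ v) else 0)"
      using A by (simp add: sum.inter_filter)
    also have "\<dots> = (\<Sum>e\<in>A. b * (\<Sum>v\<in>words r A. if P r (w @ [e]) v then \<mu> ((w @ [e]) @ v) else 0))"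
      by (simp only: sum_words_Suc P_Suc sum_distrib_left append_assoc append_Cons append_Nil)
    also have "\<dots> = (\<Sum>e\<in>A. b * (\<Sum>v | v \<in> words r A \<and> P r (w @ [e]) v. \<mu> ((w @ [e]) @ v)))"
      by (intro sum.cong refl arg_cong[where f = "\<lambda>y. b * y"] sum.inter_filter[symmetric] finite_words A)
    also have "\<dots> \<le> (\<Sum>e\<in>A. K * (\<Sum>v\<in>words r A. f ((w @ [e]) @ v)))"
    proof (rule sum_mono)
      fix e assume "e \<in> A"
      then have "w @ [e] \<in> lists A" using Suc.prems by auto
      from Suc.IH[OF this]
      show "b * (\<Sum>v | v \<in> words r A \<and> P r (w @ [e]) v. \<mu> ((w @ [e]) @ v))
          \<le> K * (\<Sum>v\<in>words r A. f ((w @ [e]) @ v))"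
        unfolding P_def .
    qed
    also have "\<dots> = K * (\<Sum>v\<in>words (Suc r) A. f (w @ v))"
      by (simp add: sum_words_Suc sum_distrib_left)
    finally show ?thesis unfolding P_def .
  qed
qed

section \<open>The geometry of adic cubes\<close>

lemma adic_cube_measurable: "adic_cube l n k \<in> sets borel"
proof -
  have "adic_cube l n k = (\<Inter>i. {x. real (k i) / real l ^ n \<le> x $ i} \<inter>
      {x. x $ i < (real (k i) + 1) / real l ^ n})"
    by (auto simp: adic_cube_def)
  also have "\<dots> \<in> sets borel"
  proof (rule sets.finite_INT)
    fix i
    have "closed {x :: real ^ 'a. real (k i) / real l ^ n \<le> x $ i}"
      by (intro closed_Collect_le continuous_intros)
    moreover have "open {x :: real ^ 'a. x $ i < (real (k i) + 1) / real l ^ n}"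
      by (intro open_Collect_less continuous_intros)
    ultimately show "{x :: real ^ 'a. real (k i) / real l ^ n \<le> x $ i} \<inter>
      {x. x $ i < (real (k i) + 1) / real l ^ n} \<in> sets borel"
      by (intro sets.Int borel_open borel_closed)
  qed auto
  finally show ?thesis .
qed

lemma adic_cubes_subset_unit_cube:
  assumes "l > 0" "I \<in> adic_cubes l n"
  shows "I \<subseteq> unit_cube"
proof
  fix x assume "x \<in> I"
  obtain k where k: "I = adic_cube l n k" "\<And>i. k i < l ^ n"
    using assms(2) by (auto simp: adic_cubes_def)
  have pos: "real l ^ n > 0" using assms(1) by simp
  show "x \<in> unit_cube"
    unfolding unit_cube_def
  proof (intro CollectI allI)
    fix i
    have x: "real (k i) / real l ^ n \<le> x $ i" "x $ i < (real (k i) + 1) / real l ^ n"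
      using \<open>x \<in> I\<close> k(1) by (auto simp: adic_cube_def)
    have "0 \<le> real (k i) / real l ^ n" by simp
    moreover have "real (k i) + 1 \<le> real l ^ n"
      using k(2)[of i] by (metis Suc_leI of_nat_Suc of_nat_le_iff of_nat_power add.commute)
    then have "(real (k i) + 1) / real l ^ n \<le> 1" using pos by simp
    ultimately show "0 \<le> x $ i \<and> x $ i < 1" using x by linarith
  qed
qed

text \<open>The index of an adic cube is recovered from any of its points \<open>x\<close> as the integer part of
  \<open>l ^ n * x\<close>, coordinate by coordinate.\<close>

lemma adic_cubes_unique:
  assumes "l > 0" "I \<in> adic_cubes l n" "J \<in> adic_cubes l n" "x \<in> I" "x \<in> J"
  shows "I = J"
proof -
  have floor_eq: "int (k i) = \<lfloor>x $ i * real l ^ n\<rfloor>" if "x \<in> adic_cube l n k" for k i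
  proof -
    have "real (k i) / real l ^ n \<le> x $ i" "x $ i < (real (k i) + 1) / real l ^ n"
      using that by (auto simp: adic_cube_def)
    then have "real (k i) \<le> x $ i * real l ^ n" "x $ i * real l ^ n < real (k i) + 1"
      using assms(1) by (auto simp: field_simps)
    then show ?thesis by linarith
  qed
  obtain k k' where k: "I = adic_cube l n k" "J = adic_cube l n k'"
    using assms by (auto simp: adic_cubes_def)
  have "k i = k' i" for i
    using floor_eq[of k i] floor_eq[of k' i] assms(4,5) k by simp
  then have "k = k'" by (rule ext)
  with k show ?thesis by simp
qed

lemma adic_cubes_cover:
  assumes "l > 0" "x \<in> unit_cube"
  shows "\<exists>I\<in>adic_cubes l n. x \<in> I"
proof -
  define k where "k i = nat \<lfloor>x $ i * real l ^ n\<rfloor>" for i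
  have pos: "real l ^ n > 0" using assms(1) by simp
  have x: "0 \<le> x $ i" "x $ i < 1" for i using assms(2) by (auto simp: unit_cube_def)
  have k: "real (k i) \<le> x $ i * real l ^ n" "x $ i * real l ^ n < real (k i) + 1" for i
  proof -
    have "0 \<le> x $ i * real l ^ n" using x[of i] pos by simp
    then show "real (k i) \<le> x $ i * real l ^ n" "x $ i * real l ^ n < real (k i) + 1"
      unfolding k_def by linarith+
  qed
  have "k i < l ^ n" for i
  proof -
    have "real (k i) < 1 * real l ^ n"
      using k(1)[of i] mult_strict_right_mono[OF x(2)[of i] pos] by linarith
    then show ?thesis by (metis mult_1 of_nat_less_iff of_nat_power)
  qed
  then have "adic_cube l n k \<in> adic_cubes l n" by (auto simp: adic_cubes_def)
  moreover have "x \<in> adic_cube l n k"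
    using k pos by (auto simp: adic_cube_def field_simps)
  ultimately show ?thesis by blast
qed

lemma adic_cube_at_eq:
  assumes "l > 0" "I \<in> adic_cubes l n" "x \<in> I"
  shows "adic_cube_at l n x = I"
  unfolding adic_cube_at_def
  using assms by (intro the_equality) (auto dest: adic_cubes_unique[OF assms(1)])

section \<open>Quasi-Bernoulli measures\<close>

text \<open>The constant \<open>C\<close> is fixed together with the measure because the bounds on moments and
  probabilities are explicit in it.\<close>

locale quasi_Bernoulli_measure =
  fixes l :: nat and cube :: "nat list \<Rightarrow> (real ^ 'd::finite) set"
    and m :: "(real ^ 'd) measure" and C :: real and letters :: "nat set"
  assumes l_ge_2: "l \<ge> 2"
    and letters_def: "letters = {..<l ^ CARD('d)}"
    and coding: "cube_coding l cube"
    and borel_prob: "borel_prob_on_unit_cube m"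
    and C_ge_1: "C \<ge> 1"
    and product_lower: "\<lbrakk>u \<in> lists letters; v \<in> lists letters\<rbrakk> \<Longrightarrow>
        1 / C * measure m (cube u) * measure m (cube v) \<le> measure m (cube (u @ v))"
    and product_upper: "\<lbrakk>u \<in> lists letters; v \<in> lists letters\<rbrakk> \<Longrightarrow>
        measure m (cube (u @ v)) \<le> C * measure m (cube u) * measure m (cube v)"
begin

abbreviation mass :: "nat list \<Rightarrow> real" where "mass w \<equiv> measure m (cube w)"

definition partition_fun :: "real \<Rightarrow> nat \<Rightarrow> real" where
  "partition_fun t n = (\<Sum>w\<in>words n letters. mass w powr t)"

lemma finite_letters [simp]: "finite letters"
  by (simp add: letters_def)

lemma l_pos: "l > 0" and l_gt_1: "real l > 1"
  using l_ge_2 by auto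

sublocale prob_space m
  using borel_prob by (simp add: borel_prob_on_unit_cube_def)

lemma space_m: "space m = unit_cube"
  using borel_prob sets_eq_imp_space_eq[of m "restrict_space borel unit_cube"]
  by (simp add: borel_prob_on_unit_cube_def space_restrict_space)

lemma cube_bij: "bij_betw cube (words n letters) (adic_cubes l n)"
  using coding by (simp add: cube_coding_def letters_def)

lemma cube_adic: "w \<in> words n letters \<Longrightarrow> cube w \<in> adic_cubes l n"
  using cube_bij by (rule bij_betw_apply)

lemma cube_sets: 
  assumes "w \<in> words n letters" shows "cube w \<in> sets m"
proof -
  obtain k where k: "cube w = adic_cube l n k"
    using cube_adic[OF assms] by (auto simp: adic_cubes_def)
  have "cube w = unit_cube \<inter> adic_cube l n k"
    using adic_cubes_subset_unit_cube[OF l_pos cube_adic[OF assms]] k by auto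
  then have "cube w \<in> sets (restrict_space borel unit_cube)"
    unfolding sets_restrict_space using adic_cube_measurable by blast
  then show ?thesis using borel_prob by (simp add: borel_prob_on_unit_cube_def)
qed

lemma cube_append_subset:
  "u \<in> lists letters \<Longrightarrow> v \<in> lists letters \<Longrightarrow> cube (u @ v) \<subseteq> cube u"
proof (induction v rule: rev_induct)
  case (snoc e v)
  have "\<forall>w e. w \<in> lists letters \<longrightarrow> e \<in> letters \<longrightarrow> cube (w @ [e]) \<subseteq> cube w"
    using coding unfolding cube_coding_def letters_def by simp
  with snoc.prems have "cube ((u @ v) @ [e]) \<subseteq> cube (u @ v)"
    by (metis append_in_lists_conv Cons_in_lists_iff)
  with snoc show ?case by auto
qed simp

lemma cube_take_subset: "w \<in> words n letters \<Longrightarrow> cube w \<subseteq> cube (take k w)"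
  using cube_append_subset[of "take k w" "drop k w"]
  by (auto simp: words_def dest: in_set_takeD in_set_dropD)

text \<open>The past of a point is the sequence of prefixes of its code.  This turns events about
  \<open>adic_cube_at\<close> into sets of words.\<close>

lemma adic_cube_at_code:
  assumes "w \<in> words n letters" "x \<in> cube w" "k \<le> n"
  shows "adic_cube_at l k x = cube (take k w)"
  using cube_take_subset[OF assms(1), of k] assms(2)
  by (intro adic_cube_at_eq[OF l_pos cube_adic[OF take_in_words[OF assms(1,3)]]]) auto

lemma cube_cover: "x \<in> unit_cube \<Longrightarrow> \<exists>w\<in>words n letters. x \<in> cube w"
  using adic_cubes_cover[OF l_pos, of x n] cube_bij[of n] by (auto simp: bij_betw_def)

lemma disjoint_cubes: "disjoint_family_on cube (words n letters)"
proof (unfold disjoint_family_on_def, intro ballI impI)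
  fix u v assume uv: "u \<in> words n letters" "v \<in> words n letters" "u \<noteq> v"
  then have "cube u \<noteq> cube v"
    using cube_bij[of n] by (auto simp: bij_betw_def inj_on_def)
  then show "cube u \<inter> cube v = {}"
    using adic_cubes_unique[OF l_pos cube_adic[OF uv(1)] cube_adic[OF uv(2)]] by auto
qed

lemma measure_Union_cubes:
  assumes "S \<subseteq> words n letters"
  shows "measure m (\<Union>w\<in>S. cube w) = (\<Sum>w\<in>S. mass w)"
proof (rule finite_measure_finite_Union)
  show "finite S" using assms by (rule finite_subset) simp
  show "cube ` S \<subseteq> sets m" using assms cube_sets by auto
  show "disjoint_family_on cube S"
    using disjoint_cubes assms by (rule disjoint_family_on_mono[rotated])
qed

lemma sum_mass_extensions:
  assumes w: "w \<in> lists letters"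
  shows "(\<Sum>v\<in>words r letters. mass (w @ v)) \<le> mass w"
proof -
  have wr: "(@) w ` words r letters \<subseteq> words (length w + r) letters"
    using w by (auto simp: words_def)
  have ww: "w \<in> words (length w) letters" using w by (auto simp: words_def)
  have "(\<Sum>v\<in>words r letters. mass (w @ v)) = (\<Sum>u\<in>(@) w ` words r letters. mass u)"
    by (subst sum.reindex) (auto simp: inj_on_def)
  also have "\<dots> = measure m (\<Union>u\<in>(@) w ` words r letters. cube u)"
    by (rule measure_Union_cubes[OF wr, symmetric])
  also have "\<dots> \<le> mass w"
    using cube_append_subset[OF w] cube_sets[OF ww]
    by (intro finite_measure_mono) (auto dest!: words_subset_lists)
  finally show ?thesis .
qed

lemma sum_mass: "(\<Sum>w\<in>words n letters. mass w) = 1"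
proof -
  have "(\<Union>w\<in>words n letters. cube w) = space m"
    using cube_cover[of _ n] adic_cubes_subset_unit_cube[OF l_pos cube_adic]
    by (fastforce simp: space_m)
  then show ?thesis
    using measure_Union_cubes[of "words n letters" n] prob_space by simp
qed

section \<open>The spectrum controls every partition function\<close>

lemma partition_fun_pos: "partition_fun t n > 0"
proof -
  have "\<exists>w\<in>words n letters. mass w > 0"
  proof (rule ccontr)
    assume "\<not> ?thesis"
    then have "mass w = 0" if "w \<in> words n letters" for w
      using that by (simp add: zero_less_measure_iff)
    then show False using sum_mass[of n] by simp
  qed
  then obtain w where "w \<in> words n letters" "mass w > 0" by blast
  then show ?thesis
    unfolding partition_fun_def by (intro sum_pos2[of _ w]) auto
qed

text \<open>Raising the quasi-Bernoulli inequalities to the power \<open>t \<ge> 0\<close> preserves their direction also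
  for cubes of mass 0, since \<open>0 powr t = 0\<close> for every \<open>t\<close>.\<close>

lemma mass_append_powr:
  assumes "0 \<le> t" "u \<in> lists letters" "v \<in> lists letters"
  shows "C powr - t * (mass u powr t * mass v powr t) \<le> mass (u @ v) powr t"
    and "mass (u @ v) powr t \<le> C powr t * (mass u powr t * mass v powr t)"
proof -
  have C: "C > 0" using C_ge_1 by simp
  have "(1 / C * mass u * mass v) powr t \<le> mass (u @ v) powr t"
    using product_lower[OF assms(2,3)] C assms(1) by (intro powr_mono2) auto
  then show "C powr - t * (mass u powr t * mass v powr t) \<le> mass (u @ v) powr t"
    using C by (simp add: powr_mult powr_divide powr_minus divide_simps mult_ac)
  have "mass (u @ v) powr t \<le> (C * mass u * mass v) powr t"
    using product_upper[OF assms(2,3)] assms(1) by (intro powr_mono2) auto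
  then show "mass (u @ v) powr t \<le> C powr t * (mass u powr t * mass v powr t)"
    using C by (simp add: powr_mult mult_ac)
qed

lemma sum_powr_extensions:
  assumes "0 \<le> t" "u \<in> lists letters"
  shows "C powr - t * (mass u powr t * partition_fun t r) \<le> (\<Sum>v\<in>words r letters. mass (u @ v) powr t)"
    and "(\<Sum>v\<in>words r letters. mass (u @ v) powr t) \<le> C powr t * (mass u powr t * partition_fun t r)"
  unfolding partition_fun_def sum_distrib_left
  using mass_append_powr[OF assms] by (auto intro!: sum_mono dest: words_subset_lists)

lemma partition_fun_almost_multiplicative:
  assumes "0 \<le> t"
  shows "C powr - t * (partition_fun t n * partition_fun t p) \<le> partition_fun t (n + p)"
    and "partition_fun t (n + p) \<le> C powr t * (partition_fun t n * partition_fun t p)"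
proof -
  have eq: "partition_fun t (n + p) = (\<Sum>u\<in>words n letters. \<Sum>v\<in>words p letters. mass (u @ v) powr t)"
    unfolding partition_fun_def by (rule sum_words_append)
  have eq': "c * (partition_fun t n * partition_fun t p)
      = (\<Sum>u\<in>words n letters. c * (mass u powr t * partition_fun t p))" for c
    unfolding partition_fun_def[of t n] by (simp add: sum_distrib_left sum_distrib_right)
  show "C powr - t * (partition_fun t n * partition_fun t p) \<le> partition_fun t (n + p)"
    unfolding eq eq' using sum_powr_extensions(1)[OF assms] by (intro sum_mono) (auto dest: words_subset_lists)
  show "partition_fun t (n + p) \<le> C powr t * (partition_fun t n * partition_fun t p)"
    unfolding eq eq' using sum_powr_extensions(2)[OF assms] by (intro sum_mono) (auto dest: words_subset_lists)
qed

lemma partition_fun_eq_sum_cubes: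
  "(\<Sum>I \<in> {I \<in> adic_cubes l n. measure m I > 0}. measure m I powr t) = partition_fun t n"
proof -
  have "finite (adic_cubes l n :: (real ^ 'd) set set)"
    using bij_betw_finite[OF cube_bij[of n]] by simp
  then have "(\<Sum>I \<in> {I \<in> adic_cubes l n. measure m I > 0}. measure m I powr t)
      = (\<Sum>I \<in> adic_cubes l n. measure m I powr t)"
    by (intro sum.mono_neutral_left) (auto simp: zero_less_measure_iff)
  also have "\<dots> = partition_fun t n"
    unfolding partition_fun_def by (rule sum.reindex_bij_betw[OF cube_bij, symmetric])
  finally show ?thesis .
qed

text \<open>The logarithms \<open>ln (partition_fun t n)\<close> are additive up to \<open>t * ln C\<close>.  So the upper limit in
  the definition of the spectrum is a limit, and the error at generation \<open>n\<close> does not grow with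
  \<open>n\<close>.\<close>

lemma partition_fun_spectrum:
  assumes t: "0 \<le> t"
  shows "\<bar>ln (partition_fun t n) - real n * (Lq_spectrum l m t * ln (real l))\<bar> \<le> t * ln C"
proof -
  let ?Z = "partition_fun t"
  have C: "C > 0" using C_ge_1 by simp
  have "\<bar>ln (?Z (n + p)) - ln (?Z n) - ln (?Z p)\<bar> \<le> t * ln C" for n p
  proof -
    have "ln (C powr - t * (?Z n * ?Z p)) \<le> ln (?Z (n + p))"
      using partition_fun_almost_multiplicative(1)[OF t, of n p] partition_fun_pos C
      by (subst ln_le_cancel_iff) auto
    moreover have "ln (?Z (n + p)) \<le> ln (C powr t * (?Z n * ?Z p))"
      using partition_fun_almost_multiplicative(2)[OF t, of n p] partition_fun_pos C
      by (subst ln_le_cancel_iff) auto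
    moreover have "ln (C powr s * (?Z n * ?Z p)) = s * ln C + (ln (?Z n) + ln (?Z p))" for s
      using partition_fun_pos[of t] C by (simp add: ln_mult less_imp_neq[symmetric] ln_powr)
    ultimately show ?thesis by (simp add: abs_le_iff)
  qed
  then obtain L where L: "(\<lambda>n. ln (?Z n) / real n) \<longlonglongrightarrow> L"
    and bound: "\<And>n. \<bar>ln (?Z n) - real n * L\<bar> \<le> t * ln C"
    using almost_additive_asymptotics[of "\<lambda>n. ln (?Z n)"] by blast
  have "(\<lambda>n. 1 / (real n * ln (real l)) * ln (?Z n)) \<longlonglongrightarrow> L / ln (real l)"
    using tendsto_divide[OF L tendsto_const[of "ln (real l)"]] l_gt_1 by (simp add: field_simps)
  then have "limsup (\<lambda>n. ereal (1 / (real n * ln (real l)) * ln (?Z n))) = ereal (L / ln (real l))"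
    by (intro lim_imp_Limsup tendsto_intros) auto
  then have "Lq_spectrum l m t = L / ln (real l)"
    unfolding Lq_spectrum_def partition_fun_eq_sum_cubes by simp
  with bound l_gt_1 show ?thesis by simp
qed

lemma partition_fun_bounds:
  assumes t: "0 \<le> t"
  shows "partition_fun t n \<le> C powr t * real l powr (real n * Lq_spectrum l m t)"
    and "real l powr (real n * Lq_spectrum l m t) \<le> C powr t * partition_fun t n"
proof -
  have C: "C > 0" using C_ge_1 by simp
  note b = partition_fun_spectrum[OF t, of n]
  have Z: "partition_fun t n = exp (ln (partition_fun t n))"
    using partition_fun_pos by simp
  show "partition_fun t n \<le> C powr t * real l powr (real n * Lq_spectrum l m t)"
    using b C l_pos by (subst Z) (simp add: powr_def exp_add[symmetric] mult_ac abs_le_iff)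
  show "real l powr (real n * Lq_spectrum l m t) \<le> C powr t * partition_fun t n"
    using b C l_pos by (subst Z) (simp add: powr_def exp_add[symmetric] mult_ac abs_le_iff)
qed

section \<open>Probability of a large deviation up to a given time\<close>

text \<open>At a point whose cube of generation \<open>k\<close> has positive mass, the inequality divided by that mass
  reads \<open>b \<le> l powr (q * log_mass l m k x - k * Lq_spectrum l m (1 - q))\<close>.  The undivided form makes
  points in a cube of mass 0 exceptional, so that outside the set all logarithms are of
  positive numbers.\<close>

definition exceptional :: "real \<Rightarrow> nat \<Rightarrow> real \<Rightarrow> (real ^ 'd) set" where
  "exceptional q n b = {x \<in> space m. \<exists>k\<le>n. b * measure m (adic_cube_at l k x)
     \<le> measure m (adic_cube_at l k x) powr (1 - q) * real l powr - (real k * Lq_spectrum l m (1 - q))}"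

lemma exceptional_eq:
  "exceptional q n b = (\<Union>w\<in>{w \<in> words n letters. \<exists>k\<le>n. b * mass (take k w)
     \<le> mass (take k w) powr (1 - q) * real l powr - (real k * Lq_spectrum l m (1 - q))}. cube w)"
  (is "_ = (\<Union>w\<in>?S. cube w)")
proof (intro equalityI subsetI)
  fix x assume x: "x \<in> exceptional q n b"
  then obtain w where w: "w \<in> words n letters" "x \<in> cube w"
    using cube_cover[of x n] by (auto simp: exceptional_def space_m)
  with x have "w \<in> ?S" by (auto simp: exceptional_def adic_cube_at_code)
  with w show "x \<in> (\<Union>w\<in>?S. cube w)" by blast
next
  fix x assume "x \<in> (\<Union>w\<in>?S. cube w)"
  then obtain w where w: "w \<in> ?S" "x \<in> cube w" by blast
  then have "x \<in> space m"
    using cube_adic[of w n] adic_cubes_subset_unit_cube[OF l_pos] by (auto simp: space_m)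
  with w show "x \<in> exceptional q n b" by (auto simp: exceptional_def adic_cube_at_code)
qed

lemma exceptional_sets: "exceptional q n b \<in> sets m"
  unfolding exceptional_eq by (intro sets.finite_UN) (auto intro: cube_sets)

text \<open>The tree inequality applied to \<open>f w = m (cube w) powr t * l powr - (length w * \<tau> t)\<close> with
  \<open>t = 1 - q\<close>.  Passing from a cube to its descendants costs \<open>C powr t\<close> for the
  quasi-Bernoulli property and \<open>C powr t\<close> for comparing the partition function with the spectrum; the
  latter comparison is used once more for the total sum of \<open>f\<close>.  The factor is thus
  \<open>C powr (3 * t)\<close>, where \<open>t \<le> 2\<close>.\<close>

lemma measure_exceptional:
  assumes q: "\<bar>q\<bar> \<le> 1" and b: "b > 0"
  shows "measure m (exceptional q n b) \<le> C ^ 6 / b"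
proof -
  let ?\<tau> = "Lq_spectrum l m (1 - q)"
  define t where "t = 1 - q"
  have t: "0 \<le> t" "t \<le> 2" using q by (auto simp: t_def)
  have C: "C > 0" using C_ge_1 by simp
  define f where "f w = mass w powr t * real l powr - (real (length w) * ?\<tau>)" for w
  define S where "S = {w \<in> words n letters. \<exists>k\<le>n. b * mass (take k w)
     \<le> mass (take k w) powr (1 - q) * real l powr - (real k * ?\<tau>)}"
  have S: "S = {w. w \<in> words n letters \<and> (\<exists>k\<le>n. b * mass ([] @ take k w) \<le> f ([] @ take k w))}"
    unfolding S_def f_def t_def by (intro Collect_cong conj_cong ex_cong refl) (auto simp: words_def)
  have sum_f: "(\<Sum>v\<in>words r letters. f (w @ v)) =
      (\<Sum>v\<in>words r letters. mass (w @ v) powr t) * real l powr - (real (length w + r) * ?\<tau>)" for w r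
    unfolding f_def sum_distrib_right by (intro sum.cong refl) (auto simp: words_def)
  have sub: "f w \<le> C powr (2 * t) * (\<Sum>v\<in>words r letters. f (w @ v))" if w: "w \<in> lists letters" for w r
  proof -
    have "f w = C powr t * (C powr - t * (mass w powr t * real l powr (real r * ?\<tau>)))
        * real l powr - (real (length w + r) * ?\<tau>)"
    proof -
      have "C powr t * C powr - t = 1"
        using C by (simp flip: powr_add)
      moreover have "real l powr (real r * ?\<tau>) * real l powr - (real (length w + r) * ?\<tau>)
          = real l powr - (real (length w) * ?\<tau>)"
        by (simp add: algebra_simps flip: powr_add)
      ultimately show ?thesis by (simp add: f_def mult_ac)
    qed
    also have "\<dots> \<le> C powr t * (C powr - t * (mass w powr t * (C powr t * partition_fun t r)))
        * real l powr - (real (length w + r) * ?\<tau>)"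
      using partition_fun_bounds(2)[OF t(1), of r]
      by (intro mult_right_mono mult_left_mono) (auto simp: t_def)
    also have "\<dots> = C powr (2 * t) * (C powr - t * (mass w powr t * partition_fun t r))
        * real l powr - (real (length w + r) * ?\<tau>)"
      by (simp add: mult_ac flip: powr_add)
    also have "\<dots> \<le> C powr (2 * t) * (\<Sum>v\<in>words r letters. mass (w @ v) powr t)
        * real l powr - (real (length w + r) * ?\<tau>)"
      using sum_powr_extensions(1)[OF t(1) w] by (intro mult_right_mono mult_left_mono) auto
    finally show ?thesis by (simp add: sum_f mult.assoc)
  qed
  have "b * measure m (exceptional q n b) = b * (\<Sum>w\<in>S. mass ([] @ w))"
    unfolding exceptional_eq S_def[symmetric]
    by (subst measure_Union_cubes[of _ n]) (auto simp: S_def)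
  also have "\<dots> \<le> C powr (2 * t) * (\<Sum>v\<in>words n letters. f ([] @ v))"
    unfolding S using b sub sum_mass_extensions
    by (intro tree_maximal_inequality) (auto simp: f_def)
  also have "\<dots> = C powr (2 * t) * (partition_fun t n * real l powr - (real n * ?\<tau>))"
    unfolding sum_f by (simp add: partition_fun_def)
  also have "\<dots> \<le> C powr (2 * t) * ((C powr t * real l powr (real n * ?\<tau>)) * real l powr - (real n * ?\<tau>))"
    using partition_fun_bounds(1)[OF t(1), of n]
    by (intro mult_right_mono mult_left_mono) (auto simp: t_def)
  also have "\<dots> = C powr (3 * t)"
  proof -
    have "real l powr (real n * ?\<tau>) * real l powr - (real n * ?\<tau>) = 1"
      using l_pos by (simp flip: powr_add)
    then have "C powr (2 * t) * ((C powr t * real l powr (real n * ?\<tau>)) * real l powr - (real n * ?\<tau>))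
        = C powr (2 * t) * C powr t"
      by (simp only: mult.assoc mult_1_right)
    also have "\<dots> = C powr (3 * t)"
      by (simp flip: powr_add)
    finally show ?thesis .
  qed
  also have "\<dots> \<le> C powr 6"
    using C_ge_1 t by (intro powr_mono) auto
  also have "\<dots> = C ^ 6" using C by simp
  finally show ?thesis using b by (simp add: field_simps)
qed

lemma log_mass_bound:
  assumes x: "x \<in> space m" "x \<notin> exceptional q n b" and b: "b > 0" and k: "k \<le> n"
  shows "q * log_mass l m k x < log (real l) b + real k * Lq_spectrum l m (1 - q)"
proof -
  let ?M = "measure m (adic_cube_at l k x)"
  let ?\<tau> = "Lq_spectrum l m (1 - q)"
  have lt: "?M powr (1 - q) * real l powr - (real k * ?\<tau>) < b * ?M"
    using x k unfolding exceptional_def by (auto simp del: not_le simp: linorder_not_le[symmetric])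
  then have "?M \<noteq> 0" by auto
  then have M: "?M > 0" by (simp add: zero_less_measure_iff)
  have "log (real l) (?M powr (1 - q) * real l powr - (real k * ?\<tau>)) < log (real l) (b * ?M)"
    using lt M b l_gt_1 by (subst log_less_cancel_iff) auto
  then show ?thesis
    using M b l_gt_1 by (simp add: log_mult log_powr log_mass_def algebra_simps)
qed

end

section \<open>The bounds of the iterated logarithm\<close>

definition lil_scale :: "real \<Rightarrow> real \<Rightarrow> real" where
  "lil_scale b y = sqrt (2 * y * log b (log b y))"

lemma lil_scale_mono:
  assumes "1 < b" "b \<le> y" "y \<le> z"
  shows "lil_scale b y \<le> lil_scale b z"
proof -
  have 1: "1 \<le> log b y" using assms by (simp add: le_log_iff)
  moreover have 2: "log b y \<le> log b z" using assms by simp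
  ultimately have "0 \<le> log b (log b y)" "log b (log b y) \<le> log b (log b z)"
    using assms(1) by auto
  then show ?thesis unfolding lil_scale_def
    using assms by (intro real_sqrt_le_mono mult_mono) auto
qed

lemma lil_scale_pos:
  assumes "1 < b" shows "eventually (\<lambda>n. lil_scale b (real n) > 0) sequentially"
  unfolding lil_scale_def log_def using assms by real_asymp

lemma power_bracket:
  fixes r y :: real
  assumes "1 < r" "r ^ J \<le> y"
  obtains j where "J \<le> j" "r ^ j \<le> y" "y < r ^ Suc j"
proof -
  define N where "N = (LEAST N. y < r ^ N)"
  have ex: "\<exists>N. y < r ^ N" using real_arch_pow[OF assms(1)] .
  have N: "y < r ^ N" unfolding N_def by (rule LeastI_ex[OF ex])
  have "J < N"
    using N assms by (metis less_le_trans linorder_not_less not_less power_increasing_iff order.trans)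
  then obtain j where j: "N = Suc j" "J \<le> j" by (cases N) auto
  have "r ^ j \<le> y" using not_less_Least[of j "\<lambda>N. y < r ^ N"] j by (simp add: N_def[symmetric])
  with j N that show thesis by blast
qed

text \<open>The sign \<open>s\<close> treats deviations above (\<open>s = 1\<close>) and below (\<open>s = - 1\<close>) together: the
  exceptional sets are taken at the parameter \<open>s * q\<close>, and the quadratic bound on the spectrum
  holds on both sides of \<open>0\<close>.\<close>

lemma (in quasi_Bernoulli_measure) one_sided_bound:
  assumes spectrum: "(\<lambda>q. Lq_spectrum l m (1 - q) - (q * d + \<sigma>\<^sup>2 / 2 * q\<^sup>2)) \<in> o[at 0](\<lambda>q. q\<^sup>2)"
    and \<sigma>: "0 \<le> \<sigma>" "\<sigma> < a" and sgn: "\<bar>s\<bar> = 1"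
  shows "AE x in m. eventually (\<lambda>k. s * (log_mass l m k x - real k * d)
           \<le> a * lil_scale (real l) (real k)) sequentially"
proof -
  have a: "a > 0" using \<sigma> by simp
  have sq: "\<sigma>\<^sup>2 < a\<^sup>2" using \<sigma> by (simp add: power_strict_mono)
  obtain V where "\<sigma>\<^sup>2 < V" "V < a\<^sup>2" using dense[OF sq] by blast
  then have V: "\<sigma>\<^sup>2 < V" "V < a\<^sup>2" "0 < V" using le_less_trans[OF zero_le_power2] by auto
  have aV: "a\<^sup>2 / V > 1" using V by simp
  obtain \<rho> where \<rho>: "1 < \<rho>" "\<rho> < a\<^sup>2 / V" using dense[OF aV] by blast
  define \<beta> where "\<beta> = a\<^sup>2 / (\<rho> * V)"
  have \<beta>: "\<beta> > 1" using \<rho> V by (simp add: \<beta>_def field_simps)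
  define c where "c = log (real l) \<rho>"
  have c: "c > 0" using \<rho> l_gt_1 by (simp add: c_def)
  \<comment> \<open>The minimiser of \<open>- q * a * \<phi> + \<rho> ^ Suc j * V / 2 * q\<^sup>2\<close>, where \<open>\<phi>\<close> is the scale at \<open>\<rho> ^ j\<close>;
    the minimum is \<open>- \<beta> * log l (log l (\<rho> ^ j))\<close>.\<close>
  define q where "q j = a * lil_scale (real l) (\<rho> ^ j) / (\<rho> ^ Suc j * V)" for j
  have log_pow: "log (real l) (\<rho> ^ j) = real j * c" for j
    using \<rho> by (simp add: c_def log_nat_power)
  have scale_eq: "lil_scale (real l) (\<rho> ^ j) = sqrt (2 * \<rho> ^ j * log (real l) (real j * c))" for j
    by (simp add: lil_scale_def log_pow)
  have "eventually (\<lambda>q. norm (Lq_spectrum l m (1 - q) - (q * d + \<sigma>\<^sup>2 / 2 * q\<^sup>2))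
          \<le> (V - \<sigma>\<^sup>2) / 2 * norm (q\<^sup>2)) (at 0)"
    using landau_o.smallD[OF spectrum, of "(V - \<sigma>\<^sup>2) / 2"] V by simp
  then obtain \<delta> where \<delta>: "\<delta> > 0" and
    *: "\<And>q. q \<noteq> 0 \<Longrightarrow> \<bar>q\<bar> < \<delta> \<Longrightarrow> \<bar>Lq_spectrum l m (1 - q) - (q * d + \<sigma>\<^sup>2 / 2 * q\<^sup>2)\<bar>
          \<le> (V - \<sigma>\<^sup>2) / 2 * q\<^sup>2"
    by (auto simp: eventually_at dist_real_def)
  have quadratic: "Lq_spectrum l m (1 - q) \<le> q * d + V / 2 * q\<^sup>2" if "q \<noteq> 0" "\<bar>q\<bar> < \<delta>" for q
    using *[OF that] by (simp add: abs_le_iff field_simps)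
  have q_lim: "q \<longlonglongrightarrow> 0"
    unfolding q_def scale_eq log_def using \<rho> l_gt_1 c V a by real_asymp
  have "eventually (\<lambda>j. \<bar>q j\<bar> < min \<delta> 1) sequentially"
    using order_tendstoD(2)[OF tendsto_rabs[OF q_lim], of "min \<delta> 1"] \<delta> by simp
  moreover have "eventually (\<lambda>j. real l < \<rho> ^ j) sequentially"
    using \<rho> by real_asymp
  moreover have "eventually (\<lambda>j. 1 < real j * c) sequentially"
    using c by real_asymp
  ultimately have "eventually (\<lambda>j. \<bar>q j\<bar> < \<delta> \<and> \<bar>q j\<bar> \<le> 1 \<and> real l \<le> \<rho> ^ j \<and> 1 < real j * c) sequentially"
    by eventually_elim auto
  then obtain J where J: "\<And>j. j \<ge> J \<Longrightarrow> \<bar>q j\<bar> < \<delta> \<and> \<bar>q j\<bar> \<le> 1 \<and> real l \<le> \<rho> ^ j \<and> 1 < real j * c"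
    by (auto simp: eventually_sequentially)
  \<comment> \<open>The threshold is \<open>l\<close> to the power \<open>\<beta> * log l (log l (\<rho> ^ j))\<close>, the minimum above up to sign.\<close>
  define E where "E j = exceptional (s * q j) (nat \<lfloor>\<rho> ^ Suc j\<rfloor>) ((real j * c) powr \<beta>)" for j
  have s2: "s * s = 1" and abs_s: "\<bar>s * y\<bar> = \<bar>y\<bar>" for y
    using sgn by (auto simp: abs_mult abs_if split: if_splits)
  have summ: "summable (\<lambda>j. measure m (E j))"
  proof (rule summable_comparison_test_ev)
    show "eventually (\<lambda>j. norm (measure m (E j)) \<le> C ^ 6 * c powr - \<beta> * real j powr - \<beta>) sequentially"
      unfolding eventually_sequentially
    proof (intro exI[of _ J] allI impI)
      fix j assume j: "J \<le> j"
      have "measure m (E j) \<le> C ^ 6 / (real j * c) powr \<beta>"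
        unfolding E_def using J[OF j] by (intro measure_exceptional) (auto simp: abs_s intro!: Nat.gr0I)
      then show "norm (measure m (E j)) \<le> C ^ 6 * c powr - \<beta> * real j powr - \<beta>"
        using c by (simp add: powr_mult powr_minus divide_simps mult_ac)
    qed
    show "summable (\<lambda>j. C ^ 6 * c powr - \<beta> * real j powr - \<beta>)"
      using \<beta> by (intro summable_mult) (simp add: summable_real_powr_iff)
  qed
  have E_sets: "E j \<in> sets m" for j by (simp add: E_def exceptional_sets)
  have "AE x in m. eventually (\<lambda>j. x \<in> space m - E j) sequentially"
    by (rule borel_cantelli_AE1[OF E_sets _ summ]) (simp add: emeasure_eq_measure)
  then show ?thesis
  proof (rule AE_mp, intro AE_I2 impI)
    fix x assume x: "x \<in> space m" and "eventually (\<lambda>j. x \<in> space m - E j) sequentially"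
    then obtain N where N: "\<And>j. j \<ge> N \<Longrightarrow> x \<notin> E j" by (auto simp: eventually_sequentially)
    show "eventually (\<lambda>k. s * (log_mass l m k x - real k * d)
           \<le> a * lil_scale (real l) (real k)) sequentially"
      unfolding eventually_sequentially
    proof (intro exI[of _ "nat \<lceil>\<rho> ^ max N J\<rceil>"] allI impI)
      fix k assume "nat \<lceil>\<rho> ^ max N J\<rceil> \<le> k"
      then have "\<rho> ^ max N J \<le> real k" by linarith
      then obtain j where j: "max N J \<le> j" "\<rho> ^ j \<le> real k" "real k < \<rho> ^ Suc j"
        using power_bracket[OF \<rho>(1)] by blast
      let ?\<phi> = "lil_scale (real l) (\<rho> ^ j)"
      have Jj: "\<bar>q j\<bar> < \<delta>" "real l \<le> \<rho> ^ j" "1 < real j * c" using J[of j] j by auto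
      have \<phi>: "?\<phi> > 0" "?\<phi>\<^sup>2 = 2 * \<rho> ^ j * log (real l) (real j * c)"
        using Jj l_gt_1 \<rho> by (auto simp: scale_eq)
      have \<rho>j: "\<rho> ^ j > 0" using \<rho> by simp
      have qj: "q j > 0" using \<phi> a V \<rho> by (simp add: q_def)
      have kn: "k \<le> nat \<lfloor>\<rho> ^ Suc j\<rfloor>" using j(3) by linarith
      have b: "(real j * c) powr \<beta> > 0" using Jj by (auto intro!: Nat.gr0I)
      have "x \<notin> E j" using N j by simp
      then have "s * q j * log_mass l m k x < log (real l) ((real j * c) powr \<beta>)
          + real k * Lq_spectrum l m (1 - s * q j)"
        unfolding E_def using log_mass_bound[OF x _ b kn] by blast
      also have "\<dots> \<le> log (real l) ((real j * c) powr \<beta>) + real k * (s * q j * d + V / 2 * (s * q j)\<^sup>2)"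
        using qj Jj sgn by (intro add_left_mono mult_left_mono quadratic) (auto simp: abs_s)
      also have "(s * q j)\<^sup>2 = (q j)\<^sup>2" using s2 by (simp add: power2_eq_square mult_ac)
      finally have "q j * (s * (log_mass l m k x - real k * d))
          < \<beta> * log (real l) (real j * c) + real k * (V / 2 * (q j)\<^sup>2)"
        using Jj by (simp add: log_powr algebra_simps)
      also have "\<dots> \<le> \<beta> * log (real l) (real j * c) + \<rho> ^ Suc j * (V / 2 * (q j)\<^sup>2)"
        using j(3) V by (intro add_left_mono mult_right_mono) auto
      also have "\<beta> * log (real l) (real j * c) = a\<^sup>2 * ?\<phi>\<^sup>2 / (2 * (\<rho> ^ Suc j * V))"
        unfolding \<phi>(2) \<beta>_def using \<rho>j \<rho> V by (simp add: field_simps)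
      also have "a\<^sup>2 * ?\<phi>\<^sup>2 / (2 * (\<rho> ^ Suc j * V)) + \<rho> ^ Suc j * (V / 2 * (q j)\<^sup>2) = q j * (a * ?\<phi>)"
      proof -
        have "R * (V / 2 * (a * y / (R * V))\<^sup>2) + a\<^sup>2 * y\<^sup>2 / (2 * (R * V)) = a * y / (R * V) * (a * y)"
          if "R > 0" for R y
          using that V by (simp add: field_simps power2_eq_square)
        from this[of "\<rho> ^ Suc j" ?\<phi>] show ?thesis
          using \<rho> unfolding q_def by (simp add: add.commute)
      qed
      finally have "s * (log_mass l m k x - real k * d) \<le> a * ?\<phi>"
        using qj by (simp add: mult_less_cancel_left_pos)
      also have "\<dots> \<le> a * lil_scale (real l) (real k)"
        using lil_scale_mono[OF l_gt_1 Jj(2) j(2)] a by simp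
      finally show "s * (log_mass l m k x - real k * d) \<le> a * lil_scale (real l) (real k)" .
    qed
  qed
qed

lemma (in quasi_Bernoulli_measure) two_sided_bound:
  assumes spectrum: "(\<lambda>q. Lq_spectrum l m (1 - q) - (q * d + \<sigma>\<^sup>2 / 2 * q\<^sup>2)) \<in> o[at 0](\<lambda>q. q\<^sup>2)"
    and \<sigma>: "0 \<le> \<sigma>" "\<sigma> < a"
  shows "AE x in m. eventually (\<lambda>n. \<bar>(log_mass l m n x - real n * d) / lil_scale (real l) (real n)\<bar> \<le> a) sequentially"
  using one_sided_bound[OF assms, of 1, simplified] one_sided_bound[OF assms, of "-1", simplified]
proof eventually_elim
  case (elim x)
  from elim lil_scale_pos[OF l_gt_1] show ?case
    by eventually_elim (auto simp: abs_le_iff field_simps)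
qed

theorem theorem4p1:
  fixes l :: nat and cube :: "nat list \<Rightarrow> (real ^ 'd::finite) set"
    and m :: "(real ^ 'd) measure" and d \<sigma> :: real
  assumes "l \<ge> 2"
    and "cube_coding l cube"
    and "quasi_Bernoulli l cube m"
    and "d = - deriv (Lq_spectrum l m) 1"
    and "\<sigma> \<ge> 0"
    and "(\<lambda>q. Lq_spectrum l m (1 - q) - (q * d + \<sigma>\<^sup>2 / 2 * q\<^sup>2)) \<in> o[at 0](\<lambda>q. q\<^sup>2)"
  shows "AE x in m.
    limsup (\<lambda>n. ereal ((log_mass l m n x - real n * d) /
      sqrt (2 * real n * log (real l) (log (real l) (real n))))) \<le> ereal \<sigma> \<and>
    liminf (\<lambda>n. ereal ((log_mass l m n x - real n * d) /
      sqrt (2 * real n * log (real l) (log (real l) (real n))))) \<ge> ereal (- \<sigma>)"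
proof -
  obtain C where "borel_prob_on_unit_cube m" "C \<ge> 1"
    and "\<forall>u \<in> lists {..<l ^ CARD('d)}. \<forall>v \<in> lists {..<l ^ CARD('d)}.
        1 / C * measure m (cube u) * measure m (cube v) \<le> measure m (cube (u @ v)) \<and>
        measure m (cube (u @ v)) \<le> C * measure m (cube u) * measure m (cube v)"
    using assms(3) unfolding quasi_Bernoulli_def by blast
  with assms(1,2) interpret quasi_Bernoulli_measure l cube m C "{..<l ^ CARD('d)}"
    by unfold_locales auto
  have "AE x in m. \<forall>i. eventually (\<lambda>n. \<bar>(log_mass l m n x - real n * d) / lil_scale (real l) (real n)\<bar>
      \<le> \<sigma> + inverse (real (Suc i))) sequentially"
    unfolding AE_all_countable
    by (intro allI two_sided_bound[OF assms(6,5)]) simp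
  then show ?thesis
  proof eventually_elim
    case (elim x)
    define R where "R n = (log_mass l m n x - real n * d) / lil_scale (real l) (real n)" for n
    have R: "eventually (\<lambda>n. \<bar>R n\<bar> \<le> \<sigma> + inverse (real (Suc i))) sequentially" for i
      using elim by (simp add: R_def)
    have lim: "(\<lambda>i. ereal (\<sigma> + inverse (real (Suc i)))) \<longlonglongrightarrow> ereal (\<sigma> + 0)"
      "(\<lambda>i. ereal (- (\<sigma> + inverse (real (Suc i))))) \<longlonglongrightarrow> ereal (- (\<sigma> + 0))"
      by (intro tendsto_intros LIMSEQ_inverse_real_of_nat)+
    have "limsup (\<lambda>n. ereal (R n)) \<le> ereal (\<sigma> + inverse (real (Suc i)))" for i
      using R[of i] by (intro Limsup_bounded) (auto elim: eventually_mono)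
    then have "limsup (\<lambda>n. ereal (R n)) \<le> ereal (\<sigma> + 0)"
      by (intro LIMSEQ_le_const[OF lim(1)]) auto
    moreover have "ereal (- (\<sigma> + inverse (real (Suc i)))) \<le> liminf (\<lambda>n. ereal (R n))" for i
      using R[of i] by (intro Liminf_bounded) (auto elim: eventually_mono)
    then have "ereal (- (\<sigma> + 0)) \<le> liminf (\<lambda>n. ereal (R n))"
      by (intro LIMSEQ_le_const2[OF lim(2)]) auto
    ultimately show ?case
      by (simp add: R_def lil_scale_def)
  qed
qed

end
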